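(* Let $L\ge1$ and let $f:\mathbb{R}^d\to\mathbb{R}$ be (weakly) convex and $L$-smooth with a minimizer $x^*$. Let $(x_k)_{k\ge0}$ be the iterates of the algorithm RHGD with stepsize $0<h\le\frac{1}{7\sqrt L}$ and refreshment rates $\gamma_k=\frac{17}{2(k+9)h}$, from any $x_0\in\mathbb{R}^d$ (and $y_0=0$). Then for all $k\ge0$, $$\mathbb{E}[f(x_k)-f(x^* )]\le\frac{14\cdot\mathbb{E}\left[\|x_0-x^*\|^2\right]}{h^2(k+8)^2}.$$
   Context: $\|\cdot\|$ is the Euclidean norm. A differentiable $f$ is (weakly) convex if $f(y)\ge f(x)+\langle\nabla f(x),y-x\rangle$ for all $x,y$, and $L$-smooth if $\|\nabla f(x)-\nabla f(y)\|\le L\|x-y\|$ for all $x,y$. Randomized Hamiltonian gradient descent (RHGD) with stepsize $h>0$ and refreshment rates $\gamma_k>0$: from $x_0\in\mathbb{R}^d$ and $y_0=0$, for $k=0,1,2,\dots$ set $x_{k+\frac12}=x_k+hy_k$; $x_{k+1}=x_{k+\frac12}-h^2\nabla f(x_{k+\frac12})$; $\tilde y_{k+1}=y_k-h\nabla f(x_{k+1})$; $y_{k+1}=\tilde y_{k+1}$ with probability $1-\min(\gamma_kh,1)$ and $y_{k+1}=0$ with probability $\min(\gamma_kh,1)$, the random choice at each iteration being independent of the past. Expectations are over these random choices (for deterministic $x_0$ the expectation of functions of $x_0$ is trivial). *)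

theory Defs
  imports "HOL-Probability.Probability"
begin

definition grad :: "('a::real_inner \<Rightarrow> real) \<Rightarrow> 'a \<Rightarrow> 'a" where
  "grad f x = (THE D. GDERIV f x :> D)"

definition weakly_convex :: "('a::real_inner \<Rightarrow> real) \<Rightarrow> bool" where
  "weakly_convex f \<longleftrightarrow> (\<forall>x y. f y \<ge> f x + grad f x \<bullet> (y - x))"

definition smooth :: "real \<Rightarrow> ('a::real_inner \<Rightarrow> real) \<Rightarrow> bool" where
  "smooth L f \<longleftrightarrow> (\<forall>x y. norm (grad f x - grad f y) \<le> L * norm (x - y))"

text \<open>One trajectory of pairs \<open>(x\<^sub>k, y\<^sub>k)\<close>, as a function of the realised
  refreshment choices: \<open>r k\<close> holds iff the velocity is reset to \<open>0\<close> when passing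
  from iterate \<open>k\<close> to iterate \<open>k + 1\<close>.\<close>

primrec rhgd :: "('a::real_inner \<Rightarrow> real) \<Rightarrow> real \<Rightarrow> 'a \<Rightarrow> (nat \<Rightarrow> bool) \<Rightarrow> nat \<Rightarrow> 'a \<times> 'a" where
  "rhgd f h x\<^sub>0 r 0 = (x\<^sub>0, 0)"
| "rhgd f h x\<^sub>0 r (Suc k) =
    (let (x, y) = rhgd f h x\<^sub>0 r k;
         x_half = x + h *\<^sub>R y;
         x_next = x_half - h\<^sup>2 *\<^sub>R grad f x_half;
         y_tilde = y - h *\<^sub>R grad f x_next
     in (x_next, if r k then 0 else y_tilde))"

text \<open>Since \<open>x\<^sub>0\<close> is deterministic and the \<open>k\<close>-th iterate depends only on the first \<open>k\<close>
  choices, independence of every choice from the past is mutual independence of the family.\<close>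

definition refreshments ::
    "'w measure \<Rightarrow> real \<Rightarrow> (nat \<Rightarrow> real) \<Rightarrow> (nat \<Rightarrow> 'w \<Rightarrow> bool) \<Rightarrow> bool" where
  "refreshments M h \<gamma> R \<longleftrightarrow>
     prob_space.indep_vars M (\<lambda>_. count_space UNIV) R UNIV \<and>
     (\<forall>k. measure M {\<omega> \<in> space M. R k \<omega>} = min (\<gamma> k * h) 1)"

definition rhgd_x ::
    "('a::real_inner \<Rightarrow> real) \<Rightarrow> real \<Rightarrow> 'a \<Rightarrow> (nat \<Rightarrow> 'w \<Rightarrow> bool) \<Rightarrow> nat \<Rightarrow> 'w \<Rightarrow> 'a" where
  "rhgd_x f h x\<^sub>0 R k \<omega> = fst (rhgd f h x\<^sub>0 (\<lambda>i. R i \<omega>) k)"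

end

theory Submission
  imports Defs
begin

text \<open>The proof exhibits a Lyapunov function whose expectation never increases. The stepsize is
  absorbed first: with \<open>u = h y\<close> and \<open>F = h\<^sup>2 (f x - f xstar)\<close> the method becomes the one of unit
  stepsize for the function \<open>h\<^sup>2 f\<close>, whose gradient has Lipschitz constant \<open>h\<^sup>2 L \<le> 1/49\<close>.
  Put \<open>z = x - xstar\<close>, \<open>n = k + 8\<close>, and let \<open>p = 17 / (2 (n + 1))\<close> be the probability of a reset.

  Consider an energy \<open>A F + q/2 |z|\<^sup>2 + B (z \<bullet> u) + C/2 |u|\<^sup>2\<close> with \<open>A\<close>, \<open>B\<close>, \<open>C\<close> depending on \<open>n\<close>.
  A reset only removes the terms containing \<open>u\<close>, so on average one step multiplies these by
  \<open>1 - p = (n - 15/2) / (n + 1)\<close>. This damping pays for the mixed term: the products of \<open>u\<close> with the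
  new \<open>z\<close> cancel exactly if \<open>q + (1 - p) B(n + 1) = B(n)\<close>, which \<open>q = 15\<close>, \<open>B = 2 n\<close> solves.
  The terms \<open>-B (z \<bullet> \<nabla>f)\<close> that remain are at most \<open>-B F\<close> by convexity, up to small
  errors, so \<open>A\<close> may grow by \<open>B\<close> in each step, whence \<open>A = n (n - 1)\<close>. The products of \<open>u\<close> with gradients cancel to leading order if
  \<open>(1 - p) C(n + 1)\<close> is close to \<open>A - B + q\<close>; \<open>C = n\<^sup>2 + 3 n\<close> leaves a remainder linear in \<open>n\<close>, which
  is absorbed by a negative multiple of \<open>|u|\<^sup>2\<close> and by the descent of the gradient step, worth about
  \<open>-n\<^sup>2 |\<nabla>f|\<^sup>2\<close>, of which the new kinetic term takes back only half. This is
  \<open>energy_decrease\<close>; \<open>state_energy_decrease\<close> applies it to one iteration, and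
  \<open>expected_state_energy_antimono\<close> takes expectations, using that the choice at step \<open>k\<close> is
  independent of the state at step \<open>k\<close>.

  At the start \<open>u = 0\<close> and \<open>F \<le> |z|\<^sup>2 / 49\<close>, so the energy is at most
  \<open>(56/49 + 15/2) |z|\<^sup>2 \<le> 49/4 |z|\<^sup>2\<close>. At step \<open>k\<close> it is at least
  \<open>n (n - 1) F \<ge> 7/8 n\<^sup>2 F\<close>, and \<open>(49/4) / (7/8) = 14\<close>.\<close>

section \<open>The Lyapunov function\<close>

definition energy :: "real \<Rightarrow> real \<Rightarrow> 'a::real_inner \<Rightarrow> 'a \<Rightarrow> real" where
  "energy n F z u =
     n * (n - 1) * F + 15 / 2 * (norm z)\<^sup>2 + 2 * n * (z \<bullet> u) + (n\<^sup>2 + 3 * n) / 2 * (norm u)\<^sup>2"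

text \<open>The quadratic part in \<open>(z, u)\<close> is positive semidefinite: its discriminant condition is
  \<open>(2 n)\<^sup>2 \<le> 15 (n\<^sup>2 + 3 n)\<close>.\<close>

lemma energy_ge_suboptimality:
  assumes "n \<ge> 0"
  shows "n * (n - 1) * F \<le> energy n F z u"
proof -
  have "0 \<le> (norm (15 *\<^sub>R z + (2 * n) *\<^sub>R u))\<^sup>2 + (11 * n\<^sup>2 + 45 * n) * (norm u)\<^sup>2"
    using assms by simp
  also have "\<dots> = 30 * (energy n F z u - n * (n - 1) * F)"
    unfolding energy_def power2_norm_eq_inner
    by (simp add: inner_simps inner_commute[of u z] field_simps power2_eq_square)
  finally show ?thesis by simp
qed

text \<open>Here \<open>g\<close> and \<open>g'\<close> stand for the scaled gradients at the half step and at the new iterate,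
  and the inequality compares everything in the energy balance that is quadratic in \<open>u\<close> and the
  gradients. Since \<open>g'\<close> is nearly \<open>g\<close>, the product \<open>g' \<bullet> g\<close> is nearly \<open>|g|\<^sup>2\<close>, and
  Cauchy-Schwarz reduces the claim to the nonnegativity of a quadratic form in \<open>|u|\<close> and \<open>|g|\<close>,
  that is, to a discriminant bound.\<close>

lemma quadratic_error_terms:
  fixes u g g' :: "'a::real_inner"
  assumes n: "n \<ge> 8" and close: "norm (g' - g) \<le> norm g / 49"
  shows "(n / 2 + 45) * (u \<bullet> g') + (2 * n - 15) * (u \<bullet> (g' - g))
           + (n - 15 / 2) * (n + 4) / 2 * (norm g')\<^sup>2
         \<le> (5 / 4 * n + 45 / 2) * (norm u)\<^sup>2 + n * (n - 1) * (g' \<bullet> g) + (15 / 2 - 15 / 49) * (norm g)\<^sup>2"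
proof -
  define U G where "U = norm u" and "G = norm g"
  have nn: "U \<ge> 0" "G \<ge> 0" by (auto simp: U_def G_def)
  have g': "norm g' \<le> 50 / 49 * G"
    using norm_triangle_ineq[of g "g' - g"] close by (simp add: G_def)
  have "\<bar>u \<bullet> g'\<bar> \<le> U * norm g'"
    unfolding U_def by (rule Cauchy_Schwarz_ineq2)
  also have "\<dots> \<le> U * (50 / 49 * G)"
    by (intro mult_left_mono g' nn)
  finally have ug': "\<bar>u \<bullet> g'\<bar> \<le> 50 / 49 * (U * G)" by simp
  have "\<bar>u \<bullet> (g' - g)\<bar> \<le> U * norm (g' - g)"
    unfolding U_def by (rule Cauchy_Schwarz_ineq2)
  also have "\<dots> \<le> U * (G / 49)"
    unfolding G_def by (intro mult_left_mono close nn)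
  finally have ud: "\<bar>u \<bullet> (g' - g)\<bar> \<le> 1 / 49 * (U * G)" by simp
  have "\<bar>g \<bullet> (g' - g)\<bar> \<le> G * norm (g' - g)"
    unfolding G_def by (rule Cauchy_Schwarz_ineq2)
  also have "\<dots> \<le> G * (G / 49)"
    unfolding G_def by (intro mult_left_mono close) auto
  finally have "\<bar>g \<bullet> (g' - g)\<bar> \<le> G\<^sup>2 / 49" by (simp add: power2_eq_square)
  then have "- (G\<^sup>2 / 49) \<le> g \<bullet> (g' - g)" by linarith
  then have gg': "48 / 49 * G\<^sup>2 \<le> g' \<bullet> g"
    by (simp add: G_def power2_norm_eq_inner inner_simps inner_commute)
  have g'2: "(norm g')\<^sup>2 \<le> (50 / 49)\<^sup>2 * G\<^sup>2"
    using power_mono[OF g', of 2] unfolding power_mult_distrib by simp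
  (* The form to be shown nonnegative is  b U^2 - K U G + c G^2. *)
  define K where "K = (n / 2 + 45) * (50 / 49) + (2 * n - 15) * (1 / 49)"
  define b where "b = 5 / 4 * n + 45 / 2"
  define c where "c = 48 / 49 * (n * (n - 1)) + (15 / 2 - 15 / 49)
                        - (n - 15 / 2) * (n + 4) / 2 * (50 / 49)\<^sup>2"
  have "(n / 2 + 45) * (u \<bullet> g') \<le> (n / 2 + 45) * (50 / 49 * (U * G))"
    using n ug' by (intro mult_left_mono) auto
  moreover have "(2 * n - 15) * (u \<bullet> (g' - g)) \<le> (2 * n - 15) * (1 / 49 * (U * G))"
    using n ud by (intro mult_left_mono) auto
  moreover have "K * (U * G)
      = (n / 2 + 45) * (50 / 49 * (U * G)) + (2 * n - 15) * (1 / 49 * (U * G))"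
    by (simp only: K_def distrib_right mult.assoc)
  ultimately have cross: "(n / 2 + 45) * (u \<bullet> g') + (2 * n - 15) * (u \<bullet> (g' - g)) \<le> K * (U * G)"
    by linarith
  have disc: "K\<^sup>2 \<le> 4 * b * c"
  proof -
    (* In powers of n - 8 the difference of the two sides has only positive coefficients. *)
    define m where "m = n - 8"
    have m: "m \<ge> 0" "n = m + 8" using n by (auto simp: m_def)
    show ?thesis
      unfolding K_def b_def c_def m(2) using m(1)
      by (simp add: power2_eq_square field_simps)
  qed
  have b: "b > 0" using n by (simp add: b_def)
  have "0 \<le> (2 * b * U - K * G)\<^sup>2 + (4 * b * c - K\<^sup>2) * G\<^sup>2"
    using disc by simp
  also have "\<dots> = 4 * b * (b * U\<^sup>2 - K * (U * G) + c * G\<^sup>2)"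
    by (simp add: power2_eq_square algebra_simps)
  finally have quad: "0 \<le> b * U\<^sup>2 - K * (U * G) + c * G\<^sup>2"
    using b by (simp add: zero_le_mult_iff)
  have "n * (n - 1) * (48 / 49 * G\<^sup>2) \<le> n * (n - 1) * (g' \<bullet> g)"
    using n by (intro mult_left_mono gg') auto
  moreover have "(n - 15 / 2) * (n + 4) / 2 * (norm g')\<^sup>2
      \<le> (n - 15 / 2) * (n + 4) / 2 * ((50 / 49)\<^sup>2 * G\<^sup>2)"
    using n by (intro mult_left_mono g'2) auto
  moreover have "c * G\<^sup>2 = n * (n - 1) * (48 / 49 * G\<^sup>2) + (15 / 2 - 15 / 49) * G\<^sup>2
      - (n - 15 / 2) * (n + 4) / 2 * ((50 / 49)\<^sup>2 * G\<^sup>2)"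
    unfolding c_def by algebra
  ultimately show ?thesis
    using cross quad unfolding b_def U_def[symmetric] G_def[symmetric] by linarith
qed

text \<open>The decrease is an algebraic identity: the change of energy equals a combination of the
  three convexity inequalities, with weights \<open>n (n - 1)\<close>, \<open>2 n - 15\<close> and \<open>15\<close>, plus the error
  terms of the preceding lemma. The last two weights sum to \<open>2 n\<close>, the growth of the coefficient
  of \<open>F\<close>. The assumption on \<open>g \<bullet> z'\<close> is convexity at the half step: the descent made by the gradient
  step from there offsets \<open>|g|\<^sup>2\<close> up to the Lipschitz error.\<close>

lemma energy_decrease:
  fixes z u g g' :: "'a::real_inner"
  assumes n: "n \<ge> 8" and close: "norm (g' - g) \<le> norm g / 49"
    and z': "z' = z + u - g"
    and step: "F' - F \<le> g' \<bullet> (u - g)"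
    and opt': "F' \<le> g' \<bullet> z'"
    and opt: "F' - (norm g)\<^sup>2 / 49 \<le> g \<bullet> z'"
    and p: "p = 17 / (2 * (n + 1))"
  shows "p * energy (n + 1) F' z' 0 + (1 - p) * energy (n + 1) F' z' (u - g') \<le> energy n F z u"
proof -
  have "p * energy (n + 1) F' z' 0 + (1 - p) * energy (n + 1) F' z' (u - g')
      = n * (n + 1) * F' + 15 / 2 * (norm z')\<^sup>2
        + ((1 - p) * (n + 1)) * (2 * (z' \<bullet> (u - g')) + (n + 4) / 2 * (norm (u - g'))\<^sup>2)"
    unfolding energy_def by (simp add: field_simps power2_eq_square)
  also have "(1 - p) * (n + 1) = n - 15 / 2"
    using n by (simp add: p field_simps)
  finally have lhs: "p * energy (n + 1) F' z' 0 + (1 - p) * energy (n + 1) F' z' (u - g')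
      = n * (n + 1) * F' + 15 / 2 * (norm z')\<^sup>2
        + (n - 15 / 2) * (2 * (z' \<bullet> (u - g')) + (n + 4) / 2 * (norm (u - g'))\<^sup>2)" .
  have z: "z = z' - u + g" by (simp add: z')
  have "n * (n + 1) * F' + 15 / 2 * (norm z')\<^sup>2
        + (n - 15 / 2) * (2 * (z' \<bullet> (u - g')) + (n + 4) / 2 * (norm (u - g'))\<^sup>2) - energy n F z u
      = n * (n - 1) * (F' - F - g' \<bullet> (u - g))
        + (2 * n - 15) * (F' - g' \<bullet> z') + 15 * (F' - (norm g)\<^sup>2 / 49 - g \<bullet> z')
        + ((n / 2 + 45) * (u \<bullet> g') + (2 * n - 15) * (u \<bullet> (g' - g))
           + (n - 15 / 2) * (n + 4) / 2 * (norm g')\<^sup>2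
           - ((5 / 4 * n + 45 / 2) * (norm u)\<^sup>2 + n * (n - 1) * (g' \<bullet> g) + (15 / 2 - 15 / 49) * (norm g)\<^sup>2))"
    unfolding energy_def z power2_norm_eq_inner
    by (simp add: inner_simps inner_commute[of u z'] inner_commute[of g z'] inner_commute[of g' z']
        inner_commute[of g u] inner_commute[of g' u] inner_commute[of g' g]
        field_simps power2_eq_square)
  moreover have "n * (n - 1) * (F' - F - g' \<bullet> (u - g)) \<le> 0"
    using n step by (intro mult_nonneg_nonpos) auto
  moreover have "(2 * n - 15) * (F' - g' \<bullet> z') \<le> 0"
    using n opt' by (intro mult_nonneg_nonpos) auto
  moreover have "15 * (F' - (norm g)\<^sup>2 / 49 - g \<bullet> z') \<le> 0"
    using opt by simp
  ultimately show ?thesis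
    using quadratic_error_terms[OF n close, of u] unfolding lhs by linarith
qed

section \<open>Independent resets\<close>

text \<open>A functional of the first \<open>k\<close> choices factors through a finite set of Boolean strings; this
  makes it measurable and bounded, hence integrable, whatever the functional is.\<close>

lemma (in prob_space) expectation_past_times_next:
  fixes R :: "nat \<Rightarrow> 'a \<Rightarrow> bool" and a :: "(nat \<Rightarrow> bool) \<Rightarrow> real" and \<phi> :: "bool \<Rightarrow> real"
  assumes ind: "indep_vars (\<lambda>_. count_space UNIV) R UNIV"
    and past: "\<And>r s. (\<And>i. i < k \<Longrightarrow> r i = s i) \<Longrightarrow> a r = a s"
  shows "integrable M (\<lambda>\<omega>. a (\<lambda>i. R i \<omega>))"
    and "integrable M (\<lambda>\<omega>. \<phi> (R k \<omega>) * a (\<lambda>i. R i \<omega>))"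
    and "expectation (\<lambda>\<omega>. \<phi> (R k \<omega>) * a (\<lambda>i. R i \<omega>))
      = expectation (\<lambda>\<omega>. \<phi> (R k \<omega>)) * expectation (\<lambda>\<omega>. a (\<lambda>i. R i \<omega>))"
proof -
  define X where "X \<omega> = (\<lambda>i\<in>{..<k}. R i \<omega>)" for \<omega>
  define Y where "Y \<omega> = (\<lambda>i\<in>{k}. R i \<omega>)" for \<omega>
  let ?B = "\<lambda>_. count_space UNIV :: bool measure"
  have aX: "a (\<lambda>i. R i \<omega>) = (a \<circ> X) \<omega>" for \<omega>
    by (auto simp: X_def intro!: past)
  have \<phi>Y: "\<phi> (R k \<omega>) = ((\<lambda>s. \<phi> (s k)) \<circ> Y) \<omega>" for \<omega>
    by (simp add: Y_def)
  have "indep_var (PiM {k} ?B) Y (PiM {..<k} ?B) X"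
    using indep_var_restrict[OF ind, of "{k}" "{..<k}"] unfolding X_def Y_def by simp
  then have iv: "indep_var borel ((\<lambda>s. \<phi> (s k)) \<circ> Y) borel (a \<circ> X)"
    using indep_var_compose[of "PiM {k} ?B" Y "PiM {..<k} ?B" X "\<lambda>s. \<phi> (s k)" borel a borel]
    by (simp add: count_space_PiM_finite)
  have fin: "finite (PiE {..<k} (\<lambda>_. UNIV :: bool set))"
    by (intro finite_PiE) auto
  have mX: "a \<circ> X \<in> borel_measurable M" and mY: "(\<lambda>s. \<phi> (s k)) \<circ> Y \<in> borel_measurable M"
    using indep_var_rv1[OF iv] indep_var_rv2[OF iv] by auto
  have intX: "integrable M (a \<circ> X)"
  proof (rule integrable_const_bound[OF _ mX])
    have "norm ((a \<circ> X) \<omega>) \<le> (\<Sum>s\<in>PiE {..<k} (\<lambda>_. UNIV). \<bar>a s\<bar>)" for \<omega>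
      using member_le_sum[of "X \<omega>" "PiE {..<k} (\<lambda>_. UNIV)" "\<lambda>s. \<bar>a s\<bar>"] fin
      by (simp add: X_def)
    then show "AE \<omega> in M. norm ((a \<circ> X) \<omega>) \<le> (\<Sum>s\<in>PiE {..<k} (\<lambda>_. UNIV). \<bar>a s\<bar>)"
      by simp
  qed
  have intY: "integrable M ((\<lambda>s. \<phi> (s k)) \<circ> Y)"
  proof (rule integrable_const_bound[OF _ mY])
    show "AE \<omega> in M. norm (((\<lambda>s. \<phi> (s k)) \<circ> Y) \<omega>) \<le> max \<bar>\<phi> True\<bar> \<bar>\<phi> False\<bar>"
    proof (intro AE_I2)
      fix \<omega>
      show "norm (((\<lambda>s. \<phi> (s k)) \<circ> Y) \<omega>) \<le> max \<bar>\<phi> True\<bar> \<bar>\<phi> False\<bar>"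
        by (cases "R k \<omega>") (simp_all add: Y_def)
    qed
  qed
  show "integrable M (\<lambda>\<omega>. a (\<lambda>i. R i \<omega>))"
    unfolding aX using intX by (simp add: comp_def)
  show "integrable M (\<lambda>\<omega>. \<phi> (R k \<omega>) * a (\<lambda>i. R i \<omega>))"
    unfolding aX \<phi>Y by (rule indep_var_integrable[OF iv intY intX])
  show "expectation (\<lambda>\<omega>. \<phi> (R k \<omega>) * a (\<lambda>i. R i \<omega>))
      = expectation (\<lambda>\<omega>. \<phi> (R k \<omega>)) * expectation (\<lambda>\<omega>. a (\<lambda>i. R i \<omega>))"
    unfolding aX \<phi>Y by (rule indep_var_lebesgue_integral[OF iv intY intX])
qed

text \<open>Averaging over the next choice inside the expectation; this takes the place of conditioning
  on the past.\<close>

lemma (in prob_space) expectation_choice: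
  fixes R :: "nat \<Rightarrow> 'a \<Rightarrow> bool" and a b :: "(nat \<Rightarrow> bool) \<Rightarrow> real"
  assumes ind: "indep_vars (\<lambda>_. count_space UNIV) R UNIV"
    and a: "\<And>r s. (\<And>i. i < k \<Longrightarrow> r i = s i) \<Longrightarrow> a r = a s"
    and b: "\<And>r s. (\<And>i. i < k \<Longrightarrow> r i = s i) \<Longrightarrow> b r = b s"
    and p: "prob {\<omega> \<in> space M. R k \<omega>} = p"
  shows "expectation (\<lambda>\<omega>. if R k \<omega> then a (\<lambda>i. R i \<omega>) else b (\<lambda>i. R i \<omega>))
      = expectation (\<lambda>\<omega>. p * a (\<lambda>i. R i \<omega>) + (1 - p) * b (\<lambda>i. R i \<omega>))"
proof -
  note A = expectation_past_times_next[where a = a and k = k, OF ind a]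
  note B = expectation_past_times_next[where a = b and k = k, OF ind b]
  have "random_variable (count_space UNIV) (R k)"
    using ind by (auto simp: indep_vars_def)
  then have ev: "{\<omega> \<in> space M. R k \<omega>} \<in> events"
    using measurable_sets[of "R k" M "count_space UNIV" "{True}"]
    by (simp add: vimage_def Int_def conj_commute)
  have "expectation (\<lambda>\<omega>. of_bool (R k \<omega>)) = expectation (indicator {\<omega> \<in> space M. R k \<omega>} :: 'a \<Rightarrow> real)"
    by (intro Bochner_Integration.integral_cong) (auto simp: indicator_def)
  also have "\<dots> = p"
    using ev p by simp
  finally have T: "expectation (\<lambda>\<omega>. of_bool (R k \<omega>)) = p" .
  have "integrable M (\<lambda>\<omega>. of_bool (R k \<omega>) * 1 :: real)"
    by (rule expectation_past_times_next(2)[OF ind, where a = "\<lambda>_. 1" and \<phi> = of_bool and k = k]) simp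
  then have N: "expectation (\<lambda>\<omega>. 1 - of_bool (R k \<omega>)) = 1 - p"
    using T prob_space by simp
  have "expectation (\<lambda>\<omega>. if R k \<omega> then a (\<lambda>i. R i \<omega>) else b (\<lambda>i. R i \<omega>))
      = expectation (\<lambda>\<omega>. of_bool (R k \<omega>) * a (\<lambda>i. R i \<omega>) + (1 - of_bool (R k \<omega>)) * b (\<lambda>i. R i \<omega>))"
    by (intro Bochner_Integration.integral_cong) auto
  also have "\<dots> = p * expectation (\<lambda>\<omega>. a (\<lambda>i. R i \<omega>)) + (1 - p) * expectation (\<lambda>\<omega>. b (\<lambda>i. R i \<omega>))"
    using A(2,3)[where \<phi> = of_bool] B(2,3)[where \<phi> = "\<lambda>c. 1 - of_bool c"] T N by simp
  also have "\<dots> = expectation (\<lambda>\<omega>. p * a (\<lambda>i. R i \<omega>) + (1 - p) * b (\<lambda>i. R i \<omega>))"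
    using A(1) B(1) by simp
  finally show ?thesis .
qed

section \<open>Decrease of the energy along the iteration\<close>

lemma rhgd_depends_on_past:
  "(\<And>i. i < k \<Longrightarrow> r i = s i) \<Longrightarrow> rhgd f h x\<^sub>0 r k = rhgd f h x\<^sub>0 s k"
  by (induction k) (simp_all add: Let_def)

text \<open>Convexity at the point \<open>y\<close> obtained from the minimizer by a short gradient step makes
  \<open>grad f y \<bullet> grad f xstar\<close> nonpositive, since \<open>f y \<ge> f xstar\<close>. For a short step
  the two gradients are within half the norm of \<open>grad f xstar\<close>, which then has to vanish.\<close>

lemma grad_minimizer_eq_0:
  assumes conv: "weakly_convex f" and sm: "smooth L f" and L: "L > 0"
    and min: "\<And>x. f xstar \<le> f x"
  shows "grad f xstar = 0"
proof -
  define g where "g = grad f xstar"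
  define y where "y = xstar - (1 / (2 * L)) *\<^sub>R g"
  have "f y + grad f y \<bullet> (xstar - y) \<le> f xstar"
    using conv by (auto simp: weakly_convex_def)
  then have "grad f y \<bullet> (xstar - y) \<le> 0"
    using min[of y] by simp
  then have le: "grad f y \<bullet> g \<le> 0"
    using L by (simp add: y_def divide_le_0_iff)
  have "norm (g - grad f y) \<le> L * norm (xstar - y)"
    using sm by (auto simp: smooth_def g_def)
  also have "\<dots> = norm g / 2"
    using L by (simp add: y_def)
  finally have "norm (g - grad f y) \<le> norm g / 2" .
  then have "(g - grad f y) \<bullet> g \<le> norm g / 2 * norm g"
    using norm_cauchy_schwarz[of "g - grad f y" g] mult_right_mono[of _ _ "norm g"]
    by (meson norm_ge_zero order_trans)
  then have "g \<bullet> g - grad f y \<bullet> g \<le> (g \<bullet> g) / 2"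
    by (simp add: inner_diff_left power2_norm_eq_inner flip: power2_eq_square)
  then have "g \<bullet> g \<le> 0"
    using le by linarith
  then show ?thesis
    by (metis g_def inner_eq_zero_iff inner_ge_zero order_antisym)
qed

text \<open>The index is shifted by \<open>8\<close> so that the damping factor
  \<open>(n - 15/2) / (n + 1)\<close> with \<open>n = k + 8\<close> is positive from the first step on.\<close>

definition state_energy :: "('a::real_inner \<Rightarrow> real) \<Rightarrow> 'a \<Rightarrow> real \<Rightarrow> nat \<Rightarrow> 'a \<times> 'a \<Rightarrow> real" where
  "state_energy f xstar h k s =
     energy (real k + 8) (h\<^sup>2 * (f (fst s) - f xstar)) (fst s - xstar) (h *\<^sub>R snd s)"

lemma state_energy_decrease:
  fixes f :: "'a::real_inner \<Rightarrow> real" and xstar x\<^sub>0 :: 'a and r :: "nat \<Rightarrow> bool"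
  assumes conv: "weakly_convex f" and sm: "smooth L f" and hL: "h\<^sup>2 * L \<le> 1 / 49"
    and p: "p = 17 / (2 * (real k + 9))"
  defines "next_state reset \<equiv> rhgd f h x\<^sub>0 (r(k := reset)) (Suc k)"
  shows "p * state_energy f xstar h (Suc k) (next_state True)
      + (1 - p) * state_energy f xstar h (Suc k) (next_state False)
    \<le> state_energy f xstar h k (rhgd f h x\<^sub>0 r k)"
proof -
  (* The dynamics in the scaled velocity u: half step w, scaled gradients g at w and g' at x'. *)
  obtain x y where xy: "rhgd f h x\<^sub>0 r k = (x, y)"
    by fastforce
  define u where "u = h *\<^sub>R y"
  define w where "w = x + u"
  define g where "g = h\<^sup>2 *\<^sub>R grad f w"
  define x' where "x' = w - g"
  define g' where "g' = h\<^sup>2 *\<^sub>R grad f x'"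
  have convex: "h\<^sup>2 * f a + (h\<^sup>2 *\<^sub>R grad f a) \<bullet> (b - a) \<le> h\<^sup>2 * f b" for a b
    using conv mult_left_mono[of "f a + grad f a \<bullet> (b - a)" "f b" "h\<^sup>2"]
    by (simp add: weakly_convex_def distrib_left)
  have "norm (g' - g) = h\<^sup>2 * norm (grad f x' - grad f w)"
    by (simp add: g_def g'_def flip: scaleR_diff_right)
  also have "\<dots> \<le> h\<^sup>2 * (L * norm (x' - w))"
    using sm by (intro mult_left_mono) (auto simp: smooth_def)
  also have "\<dots> = (h\<^sup>2 * L) * norm g"
    by (simp add: x'_def)
  also have "\<dots> \<le> 1 / 49 * norm g"
    by (intro mult_right_mono hL) simp
  finally have close: "norm (g' - g) \<le> norm g / 49" by simp
  have step: "h\<^sup>2 * (f x' - f xstar) - h\<^sup>2 * (f x - f xstar) \<le> g' \<bullet> (u - g)"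
    using convex[of x' x] by (simp add: g'_def x'_def w_def inner_simps algebra_simps)
  have opt': "h\<^sup>2 * (f x' - f xstar) \<le> g' \<bullet> (x' - xstar)"
    using convex[of x' xstar] by (simp add: g'_def inner_simps algebra_simps)
  (* Convexity is used twice: from w to the minimizer, and from x' back to w in place of a
     descent lemma; the Lipschitz bound then compares g' with g. *)
  have "(g - g') \<bullet> g \<le> norm (g - g') * norm g"
    by (rule norm_cauchy_schwarz)
  also have "\<dots> \<le> norm g / 49 * norm g"
    using close by (intro mult_right_mono) (auto simp: norm_minus_commute)
  finally have "g \<bullet> g - g' \<bullet> g \<le> (norm g)\<^sup>2 / 49"
    by (simp add: inner_diff_left power2_eq_square)
  moreover have "h\<^sup>2 * f x' + g' \<bullet> g \<le> h\<^sup>2 * f w"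
    using convex[of x' w] by (simp add: g'_def x'_def)
  moreover have "h\<^sup>2 * f w + g \<bullet> (xstar - w) \<le> h\<^sup>2 * f xstar"
    using convex[of w xstar] by (simp add: g_def)
  ultimately have opt: "h\<^sup>2 * (f x' - f xstar) - (norm g)\<^sup>2 / 49 \<le> g \<bullet> (x' - xstar)"
    by (simp add: x'_def inner_diff_right algebra_simps)
  have "rhgd f h x\<^sub>0 (r(k := b)) k = (x, y)" for b
    using rhgd_depends_on_past[of k "r(k := b)" r f h x\<^sub>0] xy by simp
  then have nxt: "next_state b = (x', if b then 0 else y - h *\<^sub>R grad f x')" for b
    by (simp add: next_state_def u_def w_def g_def x'_def Let_def)
  have "x' - xstar = (x - xstar) + u - g"
    by (simp add: x'_def w_def)
  from energy_decrease[OF _ close this step opt' opt, of "real k + 8" p]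
  show ?thesis
    unfolding state_energy_def xy nxt
    by (simp add: p u_def g'_def scaleR_diff_right power2_eq_square add.commute)
qed

lemma expected_state_energy_antimono:
  fixes f :: "'a::real_inner \<Rightarrow> real" and xstar x\<^sub>0 :: 'a
  assumes M: "prob_space M" and R: "refreshments M h \<gamma> R"
    and rate: "\<And>k. \<gamma> k * h = 17 / (2 * (real k + 9))"
    and conv: "weakly_convex f" and sm: "smooth L f" and hL: "h\<^sup>2 * L \<le> 1 / 49"
  defines "V k \<omega> \<equiv> state_energy f xstar h k (rhgd f h x\<^sub>0 (\<lambda>i. R i \<omega>) k)"
  shows "prob_space.expectation M (V (Suc k)) \<le> prob_space.expectation M (V k)"
proof -
  interpret prob_space M by fact
  have ind: "indep_vars (\<lambda>_. count_space UNIV) R UNIV"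
    using R by (simp add: refreshments_def)
  define p where "p = 17 / (2 * (real k + 9))"
  have p: "prob {\<omega> \<in> space M. R k \<omega>} = p"
    using R rate by (simp add: refreshments_def p_def)
  define a where "a b r = state_energy f xstar h (Suc k) (rhgd f h x\<^sub>0 (r(k := b)) (Suc k))" for b r
  have a_past: "a b r = a b s" if "\<And>i. i < k \<Longrightarrow> r i = s i" for b r s
    unfolding a_def using that
    by (intro arg_cong[of _ _ "state_energy f xstar h (Suc k)"] rhgd_depends_on_past)
       (auto simp: less_Suc_eq)
  have V_past: "state_energy f xstar h k (rhgd f h x\<^sub>0 r k) = state_energy f xstar h k (rhgd f h x\<^sub>0 s k)"
    if "\<And>i. i < k \<Longrightarrow> r i = s i" for r s
    using rhgd_depends_on_past[of k r s f h x\<^sub>0] that by simp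
  have V_eq: "V (Suc k) \<omega> = (if R k \<omega> then a True (\<lambda>i. R i \<omega>) else a False (\<lambda>i. R i \<omega>))" for \<omega>
  proof -
    have "(\<lambda>i. R i \<omega>)(k := R k \<omega>) = (\<lambda>i. R i \<omega>)" by auto
    then have "V (Suc k) \<omega> = a (R k \<omega>) (\<lambda>i. R i \<omega>)"
      by (simp only: V_def a_def)
    then show ?thesis by simp
  qed
  have "expectation (V (Suc k))
      = expectation (\<lambda>\<omega>. if R k \<omega> then a True (\<lambda>i. R i \<omega>) else a False (\<lambda>i. R i \<omega>))"
    by (intro Bochner_Integration.integral_cong V_eq refl)
  also have "\<dots> = expectation (\<lambda>\<omega>. p * a True (\<lambda>i. R i \<omega>) + (1 - p) * a False (\<lambda>i. R i \<omega>))"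
    using ind a_past a_past p by (rule expectation_choice)
  also have "\<dots> \<le> expectation (V k)"
  proof (rule integral_mono)
    show "integrable M (\<lambda>\<omega>. p * a True (\<lambda>i. R i \<omega>) + (1 - p) * a False (\<lambda>i. R i \<omega>))"
      using expectation_past_times_next(1)[where a = "a True" and k = k, OF ind a_past]
        expectation_past_times_next(1)[where a = "a False" and k = k, OF ind a_past]
      by simp
    show "integrable M (V k)"
      unfolding V_def
      by (rule expectation_past_times_next(1)[where k = k, OF ind V_past])
    show "p * a True (\<lambda>i. R i \<omega>) + (1 - p) * a False (\<lambda>i. R i \<omega>) \<le> V k \<omega>" for \<omega>
      unfolding a_def V_def by (rule state_energy_decrease[OF conv sm hL p_def])
  qed
  finally show ?thesis .
qed

text \<open>As the gradient vanishes at the minimizer, convexity and the Lipschitz bound give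
  \<open>f x - f xstar \<le> L |x - xstar|\<^sup>2\<close>.\<close>

lemma initial_energy_bound:
  fixes f :: "'a::real_inner \<Rightarrow> real"
  assumes conv: "weakly_convex f" and sm: "smooth L f" and hL: "h\<^sup>2 * L \<le> 1 / 49"
    and L: "L > 0" and min: "\<And>x. f xstar \<le> f x"
  shows "state_energy f xstar h 0 (x, 0) \<le> 49 / 4 * (norm (x - xstar))\<^sup>2"
proof -
  have "f x + grad f x \<bullet> (xstar - x) \<le> f xstar"
    using conv by (auto simp: weakly_convex_def)
  then have "f x - f xstar \<le> grad f x \<bullet> (x - xstar)"
    by (simp add: inner_diff_right)
  also have "\<dots> \<le> norm (grad f x) * norm (x - xstar)"
    by (rule norm_cauchy_schwarz)
  also have "norm (grad f x) \<le> L * norm (x - xstar)"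
    using sm grad_minimizer_eq_0[OF conv sm L min]
    by (metis diff_zero smooth_def)
  then have "norm (grad f x) * norm (x - xstar) \<le> L * norm (x - xstar) * norm (x - xstar)"
    by (intro mult_right_mono) auto
  finally have "f x - f xstar \<le> L * (norm (x - xstar))\<^sup>2"
    by (simp add: power2_eq_square)
  then have "h\<^sup>2 * (f x - f xstar) \<le> h\<^sup>2 * (L * (norm (x - xstar))\<^sup>2)"
    by (intro mult_left_mono) auto
  also have "\<dots> = (h\<^sup>2 * L) * (norm (x - xstar))\<^sup>2"
    by simp
  also have "\<dots> \<le> 1 / 49 * (norm (x - xstar))\<^sup>2"
    by (intro mult_right_mono hL) simp
  finally show ?thesis
    by (simp add: state_energy_def energy_def)
       (use zero_le_power2[of "norm (x - xstar)"] in linarith)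
qed

section \<open>The convergence rate\<close>

theorem theorem5:
  fixes f :: "real ^ 'd \<Rightarrow> real"
    and x\<^sub>0 xstar :: "real ^ 'd"
    and L h :: real
    and \<gamma> :: "nat \<Rightarrow> real"
    and M :: "'w measure"
    and R :: "nat \<Rightarrow> 'w \<Rightarrow> bool"
    and k :: nat
  assumes "L \<ge> 1"
    and "\<And>x. f differentiable (at x)"
    and "weakly_convex f"
    and "smooth L f"
    and "\<And>x. f xstar \<le> f x"
    and "0 < h" and "h \<le> 1 / (7 * sqrt L)"
    and "\<And>k. \<gamma> k = 17 / (2 * (real k + 9) * h)"
    and "prob_space M"
    and "refreshments M h \<gamma> R"
  shows "prob_space.expectation M (\<lambda>\<omega>. f (rhgd_x f h x\<^sub>0 R k \<omega>) - f xstar)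
    \<le> 14 * prob_space.expectation M (\<lambda>\<omega>. (norm (rhgd_x f h x\<^sub>0 R 0 \<omega> - xstar))\<^sup>2)
        / (h\<^sup>2 * (real k + 8)\<^sup>2)"
proof -
  interpret prob_space M by fact
  define V where "V k \<omega> = state_energy f xstar h k (rhgd f h x\<^sub>0 (\<lambda>i. R i \<omega>) k)" for k \<omega>
  define D where "D = (norm (x\<^sub>0 - xstar))\<^sup>2"
  define n where "n = real k + 8"
  have "h * (7 * sqrt L) \<le> 1"
    using assms(1,7) by (simp add: field_simps)
  then have "(h * (7 * sqrt L))\<^sup>2 \<le> 1"
    using assms(1,6) by (intro power_le_one) auto
  then have hL: "h\<^sup>2 * L \<le> 1 / 49"
    using assms(1) by (simp add: power_mult_distrib)
  have rate: "\<gamma> k * h = 17 / (2 * (real k + 9))" for k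
    using assms(6,8) by simp
  have "expectation (V k) \<le> expectation (V 0)"
  proof (induction k)
    case (Suc k)
    have "expectation (V (Suc k)) \<le> expectation (V k)"
      unfolding V_def
      by (rule expected_state_energy_antimono[OF assms(9,10) rate assms(3,4) hL])
    with Suc.IH show ?case by linarith
  qed simp
  also have "V 0 = (\<lambda>_. state_energy f xstar h 0 (x\<^sub>0, 0))"
    by (simp add: V_def fun_eq_iff)
  also have "expectation \<dots> \<le> 49 / 4 * D"
    using initial_energy_bound[OF assms(3,4) hL _ assms(5), of x\<^sub>0] assms(1)
    by (simp add: D_def prob_space)
  finally have V: "expectation (V k) \<le> 49 / 4 * D" .
  have ind: "indep_vars (\<lambda>_. count_space UNIV) R UNIV"
    using assms(10) by (simp add: refreshments_def)
  have integrable_state: "integrable M (\<lambda>\<omega>. \<phi> (rhgd f h x\<^sub>0 (\<lambda>i. R i \<omega>) k))"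
    for \<phi> :: "(real ^ 'd) \<times> (real ^ 'd) \<Rightarrow> real"
    by (rule expectation_past_times_next(1)
          [where k = k and a = "\<lambda>r. \<phi> (rhgd f h x\<^sub>0 r k)", OF ind])
       (rule arg_cong[of _ _ \<phi>, OF rhgd_depends_on_past], simp)
  define S where "S = expectation (\<lambda>\<omega>. f (rhgd_x f h x\<^sub>0 R k \<omega>) - f xstar)"
  have "n * (n - 1) * h\<^sup>2 * S
      = expectation (\<lambda>\<omega>. n * (n - 1) * (h\<^sup>2 * (f (rhgd_x f h x\<^sub>0 R k \<omega>) - f xstar)))"
    by (simp add: S_def mult.assoc)
  also have "\<dots> \<le> expectation (V k)"
  proof (rule integral_mono)
    show "integrable M (\<lambda>\<omega>. n * (n - 1) * (h\<^sup>2 * (f (rhgd_x f h x\<^sub>0 R k \<omega>) - f xstar)))"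
      unfolding rhgd_x_def
      by (rule integrable_state[of "\<lambda>s. n * (n - 1) * (h\<^sup>2 * (f (fst s) - f xstar))"])
    show "integrable M (V k)"
      unfolding V_def by (rule integrable_state)
    show "n * (n - 1) * (h\<^sup>2 * (f (rhgd_x f h x\<^sub>0 R k \<omega>) - f xstar)) \<le> V k \<omega>" for \<omega>
      unfolding V_def state_energy_def rhgd_x_def n_def
      by (rule energy_ge_suboptimality) simp
  qed
  also note V
  finally have S: "n * (n - 1) * h\<^sup>2 * S \<le> 49 / 4 * D" .
  have "S \<ge> 0"
    unfolding S_def using assms(5) by (intro integral_nonneg_AE) simp
  (* n - 1 is at least 7 n / 8, as n is at least 8 *)
  then have "n * 7 * (h\<^sup>2 * S) \<le> (n - 1) * 8 * (h\<^sup>2 * S)"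
    by (intro mult_right_mono) (auto simp: n_def)
  then have "n * (n * 7 * (h\<^sup>2 * S)) \<le> n * ((n - 1) * 8 * (h\<^sup>2 * S))"
    by (rule mult_left_mono) (simp add: n_def)
  with S have "n\<^sup>2 * h\<^sup>2 * S \<le> 14 * D"
    by (simp add: power2_eq_square algebra_simps)
  then have "S \<le> 14 * D / (h\<^sup>2 * n\<^sup>2)"
    using assms(6) by (simp add: n_def pos_le_divide_eq mult.commute mult.left_commute)
  then show ?thesis
    by (simp add: S_def D_def n_def rhgd_x_def prob_space)
qed

end
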